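(* Let $(K,\mathfrak{m})$ be a complete local equicharacteristic Noetherian ring of positive Krull dimension, and let $\kappa:=K/\mathfrak{m}$ be its residue field. Let $\Bbbk\subseteq K$ be a field of representatives for $(K,\mathfrak{m})$, i.e. a subring of $K$ which maps isomorphically onto $\kappa$ through the natural projection $K\to K/\mathfrak{m}=\kappa$, and regard $K$ as a $\kappa$-algebra via the resulting isomorphism $\kappa\cong\Bbbk\subseteq K$. Then $K$ is not finitely generated as a $\kappa$-algebra.
   Context: Rings are commutative. A local ring $(K,\mathfrak{m})$ is a ring with a unique maximal ideal $\mathfrak{m}$. If $K$ is Noetherian local, the $\mathfrak{m}$-adic topology is induced by the metric $d_{\mathfrak{m}}(a,b)=2^{-\sup\{k\in\mathbb{N}\,:\,a-b\in\mathfrak{m}^k\}}$ (with $2^{-\infty}=0$); $(K,\mathfrak{m})$ is a complete local Noetherian ring if $(K,d_{\mathfrak{m}})$ is a complete metric space. It is equicharacteristic if $K$ and $K/\mathfrak{m}$ have the same characteristic. By the Cohen structure theorem, a field of representatives always exists for a complete local equicharacteristic Noetherian ring. *)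

theory Defs
  imports "HOL-Analysis.Abstract_Metric_Spaces" "HOL-Library.Extended_Nat" "HOL-Algebra.Algebra"
begin

locale local_ring = cring R for R (structure) and m +
  assumes maximal: "maximalideal m R"
    and maximal_unique: "maximalideal J R \<Longrightarrow> J = m"

text \<open>In the semiring \<^term>\<open>ideals_set R\<close> the product is the product of ideals and the unit is
  \<^term>\<open>carrier R\<close>, so its powers are the powers of ideals, with zeroth power the whole ring.\<close>

abbreviation ideal_power :: "('a, 'c) ring_scheme \<Rightarrow> 'a set \<Rightarrow> nat \<Rightarrow> 'a set"
  where "ideal_power R I k \<equiv> I [^]\<^bsub>ideals_set R\<^esub> k"

text \<open>The value 0 outside the carrier is needed because the locale \<^term>\<open>Metric_space\<close> demands
  nonnegativity and symmetry on the whole type.\<close>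

definition adic_dist :: "('a, 'c) ring_scheme \<Rightarrow> 'a set \<Rightarrow> 'a \<Rightarrow> 'a \<Rightarrow> real"
  where "adic_dist R I a b =
    (if a \<in> carrier R \<and> b \<in> carrier R
     then case (SUP k\<in>{k. a \<ominus>\<^bsub>R\<^esub> b \<in> ideal_power R I k}. enat k) of
            enat n \<Rightarrow> 1 / 2 ^ n
          | \<infinity> \<Rightarrow> 0
     else 0)"

locale complete_local_noetherian_ring = local_ring R m + noetherian_ring R
  for R (structure) and m +
  assumes metric: "Metric_space (carrier R) (adic_dist R m)"
    and complete: "Metric_space.mcomplete (carrier R) (adic_dist R m)"

definition ring_char :: "('a, 'c) ring_scheme \<Rightarrow> nat"
  where "ring_char R =
    (if \<exists>n::nat. 0 < n \<and> [n] \<cdot>\<^bsub>R\<^esub> \<one>\<^bsub>R\<^esub> = \<zero>\<^bsub>R\<^esub>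
     then LEAST n::nat. 0 < n \<and> [n] \<cdot>\<^bsub>R\<^esub> \<one>\<^bsub>R\<^esub> = \<zero>\<^bsub>R\<^esub>
     else 0)"

definition equicharacteristic :: "('a, 'c) ring_scheme \<Rightarrow> 'a set \<Rightarrow> bool"
  where "equicharacteristic R m \<longleftrightarrow> ring_char R = ring_char (R Quot m)"

text \<open>Supremum of the lengths of strict chains of prime ideals. The supremum of the empty set
  being 0, the zero ring gets dimension 0.\<close>

definition krull_dim :: "('a, 'c) ring_scheme \<Rightarrow> enat"
  where "krull_dim R =
    (SUP n\<in>{n. \<exists>P :: nat \<Rightarrow> 'a set.
        (\<forall>i\<le>n. primeideal (P i) R) \<and> (\<forall>i<n. P i \<subset> P (Suc i))}. enat n)"

definition field_of_representatives :: "'a set \<Rightarrow> ('a, 'c) ring_scheme \<Rightarrow> 'a set \<Rightarrow> bool"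
  where "field_of_representatives F R m \<longleftrightarrow>
    subring F R \<and> (\<lambda>x. m +>\<^bsub>R\<^esub> x) \<in> ring_iso (R\<lparr>carrier := F\<rparr>) (R Quot m)"

text \<open>The ring \<^term>\<open>R\<close> as an algebra over \<^term>\<open>R Quot m\<close>: a residue class acts as
  multiplication by its unique representative in \<^term>\<open>F\<close>.\<close>

definition residue_algebra ::
    "('a, 'c) ring_scheme \<Rightarrow> 'a set \<Rightarrow> 'a set \<Rightarrow> ('a set, 'a) module"
  where "residue_algebra R m F =
    \<lparr>carrier = carrier R, monoid.mult = monoid.mult R, one = \<one>\<^bsub>R\<^esub>,
     ring.zero = \<zero>\<^bsub>R\<^esub>, ring.add = ring.add R,
     smult = (\<lambda>c x. inv_into F (\<lambda>y. m +>\<^bsub>R\<^esub> y) c \<otimes>\<^bsub>R\<^esub> x)\<rparr>"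

text \<open>The \<^term>\<open>R\<close>-subalgebra of \<^term>\<open>A\<close> generated by \<^term>\<open>S\<close>; additive inverses are
  obtained by multiplying with the scalar \<open>-1\<close>.\<close>

inductive_set generate_algebra ::
    "('r, 'c) ring_scheme \<Rightarrow> ('r, 'a, 'd) module_scheme \<Rightarrow> 'a set \<Rightarrow> 'a set"
  for R and A (structure) and S
  where
    scalar: "c \<in> carrier R \<Longrightarrow> c \<odot> \<one> \<in> generate_algebra R A S"
  | incl: "s \<in> S \<Longrightarrow> s \<in> generate_algebra R A S"
  | add: "x \<in> generate_algebra R A S \<Longrightarrow> y \<in> generate_algebra R A S
      \<Longrightarrow> x \<oplus> y \<in> generate_algebra R A S"
  | mult: "x \<in> generate_algebra R A S \<Longrightarrow> y \<in> generate_algebra R A S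
      \<Longrightarrow> x \<otimes> y \<in> generate_algebra R A S"

definition finitely_generated_algebra ::
    "('r, 'c) ring_scheme \<Rightarrow> ('r, 'a, 'd) module_scheme \<Rightarrow> bool"
  where "finitely_generated_algebra R A \<longleftrightarrow>
    (\<exists>S. finite S \<and> S \<subseteq> carrier A \<and> generate_algebra R A S = carrier A)"

lemma algebra_residue_algebra:
  assumes "local_ring R m" and "field_of_representatives F R m"
  shows "algebra (R Quot m) (residue_algebra R m F)"
proof -
  interpret local_ring R m by fact
  interpret I: maximalideal m R by (rule maximal)
  let ?p = "\<lambda>y. m +>\<^bsub>R\<^esub> y" and ?Q = "R Quot m"
  define g where "g = inv_into F ?p"
  have sub: "subring F R" and iso: "?p \<in> ring_iso (R\<lparr>carrier := F\<rparr>) ?Q"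
    using assms(2) by (auto simp: field_of_representatives_def)
  interpret Q: cring ?Q by (rule I.quotient_is_cring) (rule is_cring)
  have bij: "bij_betw ?p F (carrier ?Q)" using iso by (simp add: ring_iso_def)
  have gF: "g c \<in> F" if "c \<in> carrier ?Q" for c
    using that bij unfolding g_def bij_betw_def by (metis inv_into_into)
  have pg: "?p (g c) = c" if "c \<in> carrier ?Q" for c
    unfolding g_def by (rule bij_betw_inv_into_right[OF bij that])
  have gp: "g c = y" if "y \<in> F" "?p y = c" for c y
    using bij_betw_inv_into_left[OF bij] that unfolding g_def by blast
  have FR: "y \<in> carrier R" if "y \<in> F" for y
    using that subringE(1)[OF sub] by auto
  have gR: "g c \<in> carrier R" if "c \<in> carrier ?Q" for c
    using gF[OF that] FR by blast
  have g_add: "g (c \<oplus>\<^bsub>?Q\<^esub> d) = g c \<oplus>\<^bsub>R\<^esub> g d"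
    if "c \<in> carrier ?Q" "d \<in> carrier ?Q" for c d
  proof (rule gp)
    show "g c \<oplus>\<^bsub>R\<^esub> g d \<in> F" using that gF subringE(7)[OF sub] by blast
    show "?p (g c \<oplus>\<^bsub>R\<^esub> g d) = c \<oplus>\<^bsub>?Q\<^esub> d"
      using ring_hom_add[OF I.rcos_ring_hom gR[OF that(1)] gR[OF that(2)]] pg that by simp
  qed
  have g_mult: "g (c \<otimes>\<^bsub>?Q\<^esub> d) = g c \<otimes>\<^bsub>R\<^esub> g d"
    if "c \<in> carrier ?Q" "d \<in> carrier ?Q" for c d
  proof (rule gp)
    show "g c \<otimes>\<^bsub>R\<^esub> g d \<in> F" using that gF subringE(6)[OF sub] by blast
    show "?p (g c \<otimes>\<^bsub>R\<^esub> g d) = c \<otimes>\<^bsub>?Q\<^esub> d"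
      using ring_hom_mult[OF I.rcos_ring_hom gR[OF that(1)] gR[OF that(2)]] pg that by simp
  qed
  have g_one: "g \<one>\<^bsub>?Q\<^esub> = \<one>\<^bsub>R\<^esub>"
    using gp subringE(3)[OF sub] ring_hom_one[OF I.rcos_ring_hom] by blast
  have "cring (residue_algebra R m F)"
  proof (rule cringI)
    show "abelian_group (residue_algebra R m F)"
      by (rule abelian_groupI)
        (auto simp: residue_algebra_def a_ac
          intro: bexI[of _ "\<ominus>\<^bsub>R\<^esub> _"] l_neg)
    show "Group.comm_monoid (residue_algebra R m F)"
      by (rule comm_monoidI) (auto simp: residue_algebra_def m_assoc intro: m_comm)
  qed (simp add: residue_algebra_def l_distr)
  then show ?thesis
    by (rule algebraI[OF Q.is_cring])
      (auto simp: residue_algebra_def g_def[symmetric] gR g_add g_mult g_one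
        l_distr r_distr m_assoc)
qed

end

theory Submission
  imports Defs "HOL-Analysis.Urysohn"
begin

text \<open>A finitely generated algebra over a field is a countable union of finite-dimensional subspaces,
  whereas a nonempty complete metric space is not a countable union of closed sets with empty interior. The
  proof plays these two facts against each other. Write \<open>k\<close> for the field of representatives and let
  \<open>V \<subseteq> K\<close> be the \<open>k\<close>-span of finitely many elements.

  Since the powers of \<open>m\<close> intersect in \<open>0\<close>, already some single power \<open>m\<^sup>j\<close> meets \<open>V\<close> only in \<open>0\<close>
  (\<open>Span_Int_filtration_eq_zero\<close>): a descending chain of subspaces of a finite-dimensional space is
  eventually constant. This has two consequences. First, \<open>V\<close> is closed in the \<open>m\<close>-adic topology
  (\<open>closedin_Span\<close>). Second, if \<open>V\<close> has an interior point then, being a subgroup, it contains a power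
  of \<open>m\<close>; a still higher power is then contained in \<open>V\<close> and meets it only in \<open>0\<close>, so that \<open>m\<close> is
  nilpotent (\<open>ideal_power_eq_zero_if_Span_interior\<close>).

  If \<open>K\<close> were generated by finitely many elements, it would be the union of the spans of finite lists
  of monomials in them, and there are only countably many such lists. By the Baire category theorem
  one of these spans would have an interior point, so \<open>m\<close> would be nilpotent. A nilpotent ideal is
  contained in every prime ideal, so \<open>m\<close> would be the only prime ideal, and the dimension of \<open>K\<close>
  would be \<open>0\<close>.\<close>

section \<open>Finite-dimensional subspaces and separated filtrations\<close>

lemma (in ring) mem_Span_Cons_iff:
  "x \<in> Span F (u # Us) \<longleftrightarrow> (\<exists>c\<in>F. \<exists>v\<in>Span F Us. x = c \<otimes> u \<oplus> v)"
  by (simp add: line_extension_mem_iff)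

lemma (in ring) Span_Nil: "Span F [] = {\<zero>}"
  by simp

lemma (in ring) Span_append_add:
  assumes F: "subfield F R" and Us: "set Us \<subseteq> carrier R" and Vs: "set Vs \<subseteq> carrier R"
    and "x \<in> Span F Us" and "y \<in> Span F Vs"
  shows "x \<oplus> y \<in> Span F (Us @ Vs)"
proof (rule Span_subgroup_props(3)[OF F])
  show "set (Us @ Vs) \<subseteq> carrier R" using Us Vs by simp
  show "x \<in> Span F (Us @ Vs)" using mono_Span_append(1)[OF F Us Vs] assms(4) by blast
  show "y \<in> Span F (Us @ Vs)" using mono_Span_append(2)[OF F Vs Us] assms(5) by blast
qed

text \<open>Eventual constancy of the traces \<open>V \<inter> J\<^sub>i\<close>, obtained by adding one generator \<open>u\<close> at a time instead
  of comparing dimensions. If \<open>J\<^sub>j\<close> meets the span \<open>V\<close> of the earlier generators trivially, a nonzero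
  element of the larger span in \<open>J\<^sub>i\<close>, \<open>i \<ge> j\<close>, involves \<open>u\<close> and can be scaled to the form \<open>u + v\<^sub>i\<close>
  with \<open>v\<^sub>i \<in> V\<close>. Any two of the \<open>v\<^sub>i\<close> differ by an element of \<open>V \<inter> J\<^sub>j = 0\<close>, so \<open>u + v\<^sub>i\<close> does not
  depend on \<open>i\<close> and lies in every \<open>J\<^sub>i\<close>, hence is \<open>0\<close>.\<close>

lemma (in cring) Span_Int_filtration_eq_zero:
  fixes J :: "nat \<Rightarrow> 'a set"
  assumes F: "subfield F R" and Us: "set Us \<subseteq> carrier R"
    and ideal: "\<And>k. ideal (J k) R" and decr: "\<And>i k. i \<le> k \<Longrightarrow> J k \<subseteq> J i"
    and separated: "(\<Inter>k. J k) \<subseteq> {\<zero>}"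
  shows "\<exists>j. Span F Us \<inter> J j \<subseteq> {\<zero>}"
  using Us
proof (induction Us)
  case Nil
  then show ?case by (simp add: Span_Nil)
next
  case (Cons u Us)
  have u: "u \<in> carrier R" and Us: "set Us \<subseteq> carrier R" using Cons.prems by auto
  note V = Span_subgroup_props[OF F Us] Span_smult_closed[OF F Us]
  have FR: "F \<subseteq> carrier R" using subfieldE(3)[OF F] .
  obtain j where j: "Span F Us \<inter> J j \<subseteq> {\<zero>}" using Cons.IH[OF Us] by blast
  show ?case
  proof (rule ccontr)
    assume "\<not> ?thesis"
    then have nz: "\<exists>x. x \<in> Span F (u # Us) \<and> x \<in> J i \<and> x \<noteq> \<zero>" for i by blast
    have "\<exists>v\<in>Span F Us. u \<oplus> v \<in> J i \<and> u \<oplus> v \<noteq> \<zero>" if ij: "j \<le> i" for i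
    proof -
      obtain x where x: "x \<in> Span F (u # Us)" "x \<in> J i" "x \<noteq> \<zero>" using nz by blast
      then obtain c v where cv: "c \<in> F" "v \<in> Span F Us" "x = c \<otimes> u \<oplus> v"
        unfolding mem_Span_Cons_iff by blast
      have vR: "v \<in> carrier R" using cv(2) V(1) by blast
      have "c \<noteq> \<zero>"
      proof
        assume "c = \<zero>"
        then have "x = v" using cv(3) u vR by simp
        then show False using x j decr[OF ij] cv(2) by blast
      qed
      then have c: "c \<in> F - {\<zero>}" using cv(1) by simp
      have d: "inv c \<in> F" "inv c \<otimes> c = \<one>"
        using subfield_m_inv[OF F c] by simp_all
      have R: "c \<in> carrier R" "inv c \<in> carrier R" using FR cv(1) d(1) by auto
      have "inv c \<otimes> x = (inv c \<otimes> c) \<otimes> u \<oplus> inv c \<otimes> v"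
        using R u vR unfolding cv(3) by (simp add: r_distr m_assoc)
      then have eq: "inv c \<otimes> x = u \<oplus> inv c \<otimes> v" using d(2) u by simp
      have xR: "x \<in> carrier R" using ideal.Icarr[OF ideal x(2)] .
      have "c \<otimes> (inv c \<otimes> x) = x"
        using R xR d(2) by (metis m_assoc m_comm l_one)
      then have "inv c \<otimes> x \<noteq> \<zero>" using x(3) R by auto
      moreover have "inv c \<otimes> x \<in> J i" using ideal.I_l_closed[OF ideal x(2) R(2)] .
      ultimately show ?thesis using eq V(5)[OF d(1) cv(2)] by metis
    qed
    then obtain v where v: "\<And>i. j \<le> i \<Longrightarrow> v i \<in> Span F Us \<and> u \<oplus> v i \<in> J i \<and> u \<oplus> v i \<noteq> \<zero>"
      by metis
    have vR: "v i \<in> carrier R" if "j \<le> i" for i using v[OF that] V(1) by blast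
    have const: "v i = v j" if ij: "j \<le> i" for i
    proof -
      interpret Jj: ideal "J j" R by (rule ideal)
      have "u \<oplus> v i \<in> J j" "u \<oplus> v j \<in> J j"
        using v[OF ij] v[OF le_refl] decr[OF ij] by auto
      then have "(u \<oplus> v i) \<ominus> (u \<oplus> v j) \<in> J j"
        unfolding a_minus_def by (simp only: Jj.a_closed Jj.a_inv_closed)
      moreover have "(u \<oplus> v i) \<ominus> (u \<oplus> v j) = v i \<ominus> v j"
        using u vR[OF ij] vR[OF le_refl] by algebra
      moreover have "v i \<ominus> v j \<in> Span F Us"
        using v[OF ij] v[OF le_refl] unfolding a_minus_def by (intro V(3,4)) auto
      ultimately have "v i \<ominus> v j = \<zero>" using j by auto
      then show ?thesis using vR[OF ij] vR[OF le_refl] by simp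
    qed
    have "u \<oplus> v j \<in> J i" for i
    proof (cases "j \<le> i")
      case True
      then show ?thesis using v[OF True] const[OF True] by simp
    next
      case False
      then show ?thesis using v[OF le_refl] decr[of i j] by auto
    qed
    then have "u \<oplus> v j = \<zero>" using separated by blast
    then show False using v[OF le_refl] by simp
  qed
qed

section \<open>The adic metric\<close>

lemma (in cring) ideal_ideal_power:
  assumes "ideal I R"
  shows "ideal (ideal_power R I k) R"
proof -
  interpret S: semiring "ideals_set R" by (rule ideals_set_is_semiring)
  have "I [^]\<^bsub>ideals_set R\<^esub> k \<in> carrier (ideals_set R)"
    using S.nat_pow_closed assms by (simp add: ideals_set_def)
  then show ?thesis by (simp add: ideals_set_def)
qed

lemma ideal_power_simps:
  "ideal_power R I 0 = carrier R"
  "ideal_power R I (Suc k) = ideal_prod R (ideal_power R I k) I"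
  by (simp_all add: nat_pow_def ideals_set_def)

lemma (in cring) ideal_power_antimono:
  assumes I: "ideal I R" and "i \<le> k"
  shows "ideal_power R I k \<subseteq> ideal_power R I i"
  using assms(2)
proof (induction rule: dec_induct)
  case (step n)
  then show ?case
    using ideal_prod_inter[OF ideal_ideal_power[OF I, of n] I] unfolding ideal_power_simps by blast
qed simp

lemma (in cring) nat_pow_mem_ideal_power:
  assumes "a \<in> I"
  shows "a [^] (k::nat) \<in> ideal_power R I k"
proof (induction k)
  case 0
  then show ?case unfolding ideal_power_simps by simp
next
  case (Suc k)
  then show ?case unfolding ideal_power_simps nat_pow_Suc using assms by (rule ideal_prod.prod)
qed

lemma (in cring) adic_dist_le:
  assumes "a \<in> carrier R" "b \<in> carrier R" and "a \<ominus> b \<in> ideal_power R I k"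
  shows "adic_dist R I a b \<le> 1 / 2 ^ k"
proof -
  have "enat k \<le> (SUP k\<in>{k. a \<ominus> b \<in> ideal_power R I k}. enat k)"
    using assms(3) by (intro SUP_upper) simp
  then show ?thesis
    using assms(1,2) by (auto simp: adic_dist_def field_simps split: enat.split)
qed

lemma (in cring) adic_dist_less_imp_mem:
  assumes I: "ideal I R" and ab: "a \<in> carrier R" "b \<in> carrier R"
    and less: "adic_dist R I a b < 1 / 2 ^ k"
  shows "a \<ominus> b \<in> ideal_power R I k"
proof -
  let ?s = "SUP k\<in>{k. a \<ominus> b \<in> ideal_power R I k}. enat k"
  have "enat k < ?s"
  proof (cases ?s)
    case (enat n)
    then have "(1/2::real) ^ n < (1/2) ^ k"
      using less ab by (simp only: adic_dist_def power_one_over) simp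
    then have "k < n" by (simp add: power_strict_decreasing_iff)
    then show ?thesis using enat by simp
  next
    case infinity
    then show ?thesis by simp
  qed
  then obtain i where "i \<in> {k. a \<ominus> b \<in> ideal_power R I k}" "enat k < enat i"
    by (rule less_SUP_iff[THEN iffD1, THEN bexE])
  then have "a \<ominus> b \<in> ideal_power R I i" "k < i" by simp_all
  then show ?thesis using ideal_power_antimono[OF I, of k i] by auto
qed

text \<open>Two points whose difference lies in every power of \<open>I\<close> have distance \<open>0\<close>, so separation of the
  powers is part of \<^term>\<open>adic_dist R I\<close> being a metric.\<close>

lemma (in cring) Inter_ideal_power_eq_zero:
  assumes "Metric_space (carrier R) (adic_dist R I)"
  shows "(\<Inter>k. ideal_power R I k) \<subseteq> {\<zero>}"
proof
  interpret M: Metric_space "carrier R" "adic_dist R I" by fact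
  fix a assume a: "a \<in> (\<Inter>k. ideal_power R I k)"
  then have mem: "a \<in> ideal_power R I k" for k by blast
  have aR: "a \<in> carrier R" using mem[of 0] unfolding ideal_power_simps .
  then have "a \<ominus> \<zero> = a" by (simp add: a_minus_def)
  then have le: "adic_dist R I a \<zero> \<le> 1 / 2 ^ k" for k
    using adic_dist_le[OF aR zero_closed] mem by simp
  have "adic_dist R I a \<zero> = 0"
  proof (rule ccontr)
    assume "adic_dist R I a \<zero> \<noteq> 0"
    then have "0 < adic_dist R I a \<zero>" using M.nonneg by (simp add: less_le)
    then obtain k where "(1/2::real) ^ k < adic_dist R I a \<zero>"
      using real_arch_pow_inv[of _ "1/2"] by auto
    then show False using le[of k] by (simp add: power_one_over)
  qed
  then show "a \<in> {\<zero>}" using aR by simp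
qed

text \<open>A point \<open>x\<close> outside the span \<open>V\<close> has positive distance from it: \<open>V + F x\<close> is again spanned by
  finitely many elements and so meets some power \<open>I\<^sup>j\<close> only in \<open>0\<close>, but a point \<open>v \<in> V\<close> at distance less
  than \<open>2\<^sup>-\<^sup>j\<close> from \<open>x\<close> would put the nonzero element \<open>x - v\<close> into that intersection.\<close>

lemma (in cring) closedin_Span:
  assumes I: "ideal I R" and met: "Metric_space (carrier R) (adic_dist R I)"
    and F: "subfield F R" and Us: "set Us \<subseteq> carrier R"
  shows "closedin (Metric_space.mtopology (carrier R) (adic_dist R I)) (Span F Us)"
proof -
  interpret M: Metric_space "carrier R" "adic_dist R I" by fact
  note V = Span_subgroup_props[OF F Us]
  have nbhd: "\<exists>r>0. disjnt (Span F Us) (M.mball x r)" if x: "x \<in> carrier R - Span F Us" for x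
  proof -
    have xUs: "set (x # Us) \<subseteq> carrier R" using x Us by auto
    obtain j where j: "Span F (x # Us) \<inter> ideal_power R I j \<subseteq> {\<zero>}"
      using Span_Int_filtration_eq_zero[OF F xUs ideal_ideal_power[OF I]
        ideal_power_antimono[OF I] Inter_ideal_power_eq_zero[OF met]] by blast
    have "v \<notin> M.mball x (1 / 2 ^ j)" if v: "v \<in> Span F Us" for v
    proof
      assume "v \<in> M.mball x (1 / 2 ^ j)"
      then have "x \<ominus> v \<in> ideal_power R I j"
        using adic_dist_less_imp_mem[OF I] unfolding M.in_mball by blast
      moreover have "x \<ominus> v \<in> Span F (x # Us)"
        unfolding a_minus_def
      proof (intro Span_subgroup_props(3,4)[OF F xUs])
        show "x \<in> Span F (x # Us)" using Span_base_incl[OF F xUs] by simp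
        show "v \<in> Span F (x # Us)" using mono_Span[OF F Us] x v by blast
      qed
      ultimately have "x \<ominus> v = \<zero>" using j by blast
      moreover have "v \<in> carrier R" using v V(1) by blast
      ultimately have "x = v" using x by simp
      then show False using x v by blast
    qed
    then have "disjnt (Span F Us) (M.mball x (1 / 2 ^ j))" unfolding disjnt_iff by blast
    moreover have "(0::real) < 1 / 2 ^ j" by simp
    ultimately show ?thesis by blast
  qed
  show ?thesis
    unfolding M.closedin_metric
  proof (intro conjI allI impI)
    show "Span F Us \<subseteq> carrier R" by (rule V(1))
    fix x assume "x \<in> carrier R - Span F Us"
    then show "\<exists>r>0. disjnt (Span F Us) (M.mball x r)" by (rule nbhd)
  qed
qed

text \<open>A ball around \<open>x\<close> contains \<open>x + I\<^sup>k\<close> for large \<open>k\<close>. If it lies in the span, so does \<open>I\<^sup>k\<close>, by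
  subtracting \<open>x\<close>; but a high enough power of \<open>I\<close> meets the span only in \<open>0\<close>.\<close>

lemma (in cring) ideal_power_eq_zero_if_Span_interior:
  assumes I: "ideal I R" and met: "Metric_space (carrier R) (adic_dist R I)"
    and F: "subfield F R" and Us: "set Us \<subseteq> carrier R"
    and interior: "((Metric_space.mtopology (carrier R) (adic_dist R I)) interior_of (Span F Us)) \<noteq> {}"
  shows "\<exists>j. ideal_power R I j \<subseteq> {\<zero>}"
proof -
  interpret M: Metric_space "carrier R" "adic_dist R I" by fact
  note V = Span_subgroup_props[OF F Us]
  obtain x r where x: "x \<in> carrier R" and r: "0 < r" "M.mball x r \<subseteq> Span F Us"
    using interior unfolding M.metric_interior_of by blast
  then obtain k where k: "(1/2::real) ^ k < r" using real_arch_pow_inv[of _ "1/2"] by auto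
  have sub: "a \<in> Span F Us" if a: "a \<in> ideal_power R I k" for a
  proof -
    have aR: "a \<in> carrier R" using ideal.Icarr[OF ideal_ideal_power[OF I] a] .
    have "x \<ominus> (x \<oplus> a) = \<ominus> a" using x aR by algebra
    then have "x \<ominus> (x \<oplus> a) \<in> ideal_power R I k"
      using a additive_subgroup.a_inv_closed[OF ideal.axioms(1)[OF ideal_ideal_power[OF I]]] by simp
    then have "adic_dist R I x (x \<oplus> a) < r"
      using adic_dist_le[of x "x \<oplus> a" I k] x aR k by (simp add: power_one_over)
    then have "x \<oplus> a \<in> Span F Us" "x \<in> Span F Us" using r x aR by auto
    then have "(x \<oplus> a) \<oplus> \<ominus> x \<in> Span F Us" using V(3,4) by blast
    moreover have "(x \<oplus> a) \<oplus> \<ominus> x = a" using x aR by algebra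
    ultimately show ?thesis by simp
  qed
  obtain j where j: "Span F Us \<inter> ideal_power R I j \<subseteq> {\<zero>}"
    using Span_Int_filtration_eq_zero[OF F Us ideal_ideal_power[OF I]
        ideal_power_antimono[OF I] Inter_ideal_power_eq_zero[OF met]] by blast
  have "ideal_power R I (max j k) \<subseteq> {\<zero>}"
    using sub j ideal_power_antimono[OF I, of j "max j k"] ideal_power_antimono[OF I, of k "max j k"]
    by auto
  then show ?thesis ..
qed

text \<open>The Baire category argument: the whole ring has interior points, so one of the countably many
  closed spans covering it has one too.\<close>

lemma (in cring) ideal_power_eq_zero_if_countable_spans:
  assumes I: "ideal I R" and met: "Metric_space (carrier R) (adic_dist R I)"
    and complete: "Metric_space.mcomplete (carrier R) (adic_dist R I)"
    and F: "subfield F R" and M: "countable M" "M \<subseteq> carrier R"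
    and spans: "carrier R \<subseteq> (\<Union>Us\<in>lists M. Span F Us)"
  shows "\<exists>j. ideal_power R I j \<subseteq> {\<zero>}"
proof (rule ccontr)
  assume no: "\<not> ?thesis"
  interpret M: Metric_space "carrier R" "adic_dist R I" by fact
  have Us: "set Us \<subseteq> carrier R" if "Us \<in> lists M" for Us using that M(2) by auto
  have "M.mtopology interior_of (\<Union>(Span F ` lists M)) = {}"
  proof (rule M.metric_Baire_category_alt[OF complete])
    show "countable (Span F ` lists M)" using M(1) by simp
    show "closedin M.mtopology T \<and> M.mtopology interior_of T = {}" if "T \<in> Span F ` lists M" for T
      using that no closedin_Span[OF I met F Us] ideal_power_eq_zero_if_Span_interior[OF I met F Us]
      by blast
  qed
  moreover have "\<Union>(Span F ` lists M) = carrier R"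
    using spans Span_subgroup_props(1)[OF F Us] by blast
  ultimately have "carrier R = {}"
    using interior_of_topspace[of M.mtopology] by simp
  then show False using zero_closed by blast
qed

section \<open>Nilpotent maximal ideals and dimension\<close>

lemma (in primeideal) nat_pow_mem_imp_mem:
  assumes "a \<in> carrier R" and "a [^] (n::nat) \<in> I"
  shows "a \<in> I"
  using assms(2)
proof (induction n)
  case 0
  then show ?case using I_notcarr one_imp_carrier by simp
next
  case (Suc n)
  then show ?case using I_prime[of "a [^] n" a] assms(1) by auto
qed

text \<open>Every element of \<open>m\<close> is nilpotent and hence lies in every prime ideal. As \<open>m\<close> is maximal, it is
  the only prime ideal, and no strict chain has two members.\<close>

lemma (in cring) krull_dim_eq_0_if_maximal_nilpotent:
  assumes "maximalideal m R" and nil: "ideal_power R m j \<subseteq> {\<zero>}"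
  shows "krull_dim R = 0"
proof -
  interpret m: maximalideal m R by fact
  have sub: "m \<subseteq> P" if P: "primeideal P R" for P
  proof
    interpret P: primeideal P R by fact
    fix a assume a: "a \<in> m"
    have "a [^] j \<in> P" using nat_pow_mem_ideal_power[OF a, of j] nil P.zero_closed by auto
    then show "a \<in> P" using P.nat_pow_mem_imp_mem m.Icarr[OF a] by blast
  qed
  have eq: "P = m" if P: "primeideal P R" for P
  proof -
    interpret P: primeideal P R by fact
    show ?thesis using m.I_maximal[OF P.is_ideal sub[OF P] P.a_subset] P.I_notcarr by auto
  qed
  have "n = 0" if "\<forall>i\<le>n. primeideal (P i) R" "\<forall>i<n. P i \<subset> P (Suc i)"
    for n and P :: "nat \<Rightarrow> 'a set"
  proof (rule ccontr)
    assume "n \<noteq> 0"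
    then have "P 0 = m" "P (Suc 0) = m" "P 0 \<subset> P (Suc 0)" using that eq by auto
    then show False by blast
  qed
  then have "krull_dim R \<le> 0"
    unfolding krull_dim_def by (intro SUP_least) (auto simp: zero_enat_def)
  then show ?thesis by simp
qed

section \<open>Finitely generated algebras as countable unions\<close>

text \<open>Over a multiplicatively closed set \<open>M\<close>, a product of two linear combinations expands into a linear
  combination of products of elements of \<open>M\<close>.\<close>

lemma (in cring) Span_lists_mult:
  assumes F: "subfield F R" and M: "M \<subseteq> carrier R"
    and mult: "\<And>u v. u \<in> M \<Longrightarrow> v \<in> M \<Longrightarrow> u \<otimes> v \<in> M"
    and Us: "Us \<in> lists M" and Vs: "Vs \<in> lists M"
    and x: "x \<in> Span F Us" and y: "y \<in> Span F Vs"
  shows "\<exists>Ws\<in>lists M. x \<otimes> y \<in> Span F Ws"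
  using Us x
proof (induction Us arbitrary: x)
  case Nil
  have "y \<in> carrier R" using Span_subgroup_props(1)[OF F] Vs M y by blast
  then show ?case using Nil by (intro bexI[of _ "[]"]) (auto simp: Span_Nil)
next
  case (Cons u Us)
  have u: "u \<in> M" "u \<in> carrier R" and UsM: "Us \<in> lists M" and UsR: "set Us \<subseteq> carrier R"
    using Cons.hyps Cons.prems M by auto
  have VsR: "set Vs \<subseteq> carrier R" using Vs M by auto
  have FR: "F \<subseteq> carrier R" using subfieldE(3)[OF F] .
  obtain c x' where x: "c \<in> F" "x' \<in> Span F Us" "x = c \<otimes> u \<oplus> x'"
    using Cons.prems unfolding mem_Span_Cons_iff by blast
  obtain Ws where Ws: "Ws \<in> lists M" "x' \<otimes> y \<in> Span F Ws"
    using Cons.IH x(2) by blast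
  have R: "c \<in> carrier R" "x' \<in> carrier R" "y \<in> carrier R"
    using x FR Span_subgroup_props(1)[OF F UsR] Span_subgroup_props(1)[OF F VsR] y by auto
  let ?uVs = "map (\<lambda>v. v \<otimes> u) Vs"
  have uVs: "?uVs \<in> lists M" using Vs mult u by auto
  then have uVsR: "set ?uVs \<subseteq> carrier R" and WsR: "set Ws \<subseteq> carrier R" using Ws M by auto
  obtain Ks where Ks: "set Ks \<subseteq> F" "y = combine Ks Vs"
    using y Span_eq_combine_set[OF F VsR] by auto
  then have "y \<otimes> u = combine Ks ?uVs" using combine_l_distr[OF _ VsR u(2)] FR by blast
  then have "y \<otimes> u \<in> Span F ?uVs" using Span_eq_combine_set[OF F uVsR] Ks(1) by blast
  then have "c \<otimes> (y \<otimes> u) \<in> Span F ?uVs" using Span_smult_closed[OF F uVsR x(1)] by blast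
  then have "c \<otimes> (y \<otimes> u) \<oplus> x' \<otimes> y \<in> Span F (?uVs @ Ws)"
    using Span_append_add[OF F uVsR WsR] Ws(2) by blast
  moreover have "x \<otimes> y = c \<otimes> (y \<otimes> u) \<oplus> x' \<otimes> y" using x(3) R u(2) by algebra
  moreover have "?uVs @ Ws \<in> lists M" using uVs Ws(1) by auto
  ultimately show ?case by metis
qed

text \<open>Being a field is transported from the residue field along the inverse of the projection.\<close>

lemma (in local_ring) subfield_field_of_representatives:
  assumes "field_of_representatives F R m"
  shows "subfield F R"
proof -
  have sub: "subring F R" and iso: "(\<lambda>x. m +> x) \<in> ring_iso (R\<lparr>carrier := F\<rparr>) (R Quot m)"
    using assms by (auto simp: field_of_representatives_def)
  interpret m: maximalideal m R by (rule maximal)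
  interpret Q: field "R Quot m" by (rule m.quotient_is_field) (rule is_cring)
  interpret F: ring "R\<lparr>carrier := F\<rparr>" using subring_is_ring[OF sub] .
  let ?h = "inv_into F (\<lambda>x. m +> x)"
  have h: "?h \<in> ring_iso (R Quot m) (R\<lparr>carrier := F\<rparr>)"
    using ring_iso_set_sym[OF F.ring_axioms iso] by simp
  then interpret h: ring_hom_ring "R Quot m" "R\<lparr>carrier := F\<rparr>" ?h
    by unfold_locales (simp add: ring_iso_def)
  have "field (R\<lparr>carrier := F, zero := \<zero>\<rparr>)"
    using Q.ring_iso_imp_img_field[OF h] h.hom_zero by simp
  then show ?thesis using subfield_iff(1) subringE(1)[OF sub] by simp
qed

text \<open>The linear span of a multiplicative monoid is a subalgebra. It is written as a union of spans of
  finite lists because it is this union, countable when \<open>M\<close> is, to which the category argument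
  applies.\<close>

lemma (in local_ring) generate_algebra_subset_spans:
  assumes rep: "field_of_representatives F R m"
    and M: "M \<subseteq> carrier R" "\<one> \<in> M" "\<And>u v. u \<in> M \<Longrightarrow> v \<in> M \<Longrightarrow> u \<otimes> v \<in> M"
    and S: "S \<subseteq> M"
  shows "generate_algebra (R Quot m) (residue_algebra R m F) S \<subseteq> (\<Union>Us\<in>lists M. Span F Us)"
proof
  have F: "subfield F R" using subfield_field_of_representatives[OF rep] .
  have LR: "set Us \<subseteq> carrier R" if "Us \<in> lists M" for Us using that M(1) by auto
  fix x assume "x \<in> generate_algebra (R Quot m) (residue_algebra R m F) S"
  then show "x \<in> (\<Union>Us\<in>lists M. Span F Us)"
  proof induction
    case (scalar c)
    let ?g = "inv_into F (\<lambda>y. m +> y)"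
    have "(\<lambda>y. m +> y) ` F = carrier (R Quot m)"
      using rep by (auto simp: field_of_representatives_def ring_iso_def bij_betw_def)
    then have "?g c \<in> F" using scalar by (metis inv_into_into)
    moreover have "\<one> \<in> Span F [\<one>]" using Span_base_incl[OF F, of "[\<one>]"] by auto
    ultimately have "?g c \<otimes> \<one> \<in> Span F [\<one>]" using Span_smult_closed[OF F, of "[\<one>]"] by auto
    moreover have "[\<one>] \<in> lists M" using M(2) by simp
    ultimately have "?g c \<otimes> \<one> \<in> (\<Union>Us\<in>lists M. Span F Us)" by blast
    then show ?case unfolding residue_algebra_def by (simp del: Span.simps)
  next
    case (incl s)
    then have "s \<in> M" using S by blast
    then have "[s] \<in> lists M" "s \<in> Span F [s]" using Span_base_incl[OF F, of "[s]"] M(1) by auto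
    then show ?case by blast
  next
    case (add x y)
    then obtain Us Vs where L: "Us \<in> lists M" "x \<in> Span F Us" "Vs \<in> lists M" "y \<in> Span F Vs" by blast
    then have "x \<oplus>\<^bsub>R\<^esub> y \<in> Span F (Us @ Vs)"
      using Span_append_add[OF F LR LR] by blast
    moreover have "Us @ Vs \<in> lists M" using L by auto
    ultimately have "x \<oplus>\<^bsub>R\<^esub> y \<in> (\<Union>Us\<in>lists M. Span F Us)" by blast
    then show ?case unfolding residue_algebra_def by (simp del: Span.simps)
  next
    case (mult x y)
    then obtain Us Vs where L: "Us \<in> lists M" "x \<in> Span F Us" "Vs \<in> lists M" "y \<in> Span F Vs" by blast
    have "\<exists>Ws\<in>lists M. x \<otimes>\<^bsub>R\<^esub> y \<in> Span F Ws"
      by (rule Span_lists_mult[OF F M(1) _ L(1,3,2,4)]) (rule M(3))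
    then have "x \<otimes>\<^bsub>R\<^esub> y \<in> (\<Union>Us\<in>lists M. Span F Us)" by blast
    then show ?case unfolding residue_algebra_def by (simp del: Span.simps)
  qed
qed

text \<open>The monomials in the elements of \<open>S\<close>, that is the products of finite words over \<open>S\<close>.\<close>

lemma (in cring) exists_countable_monoid:
  assumes "countable S" "S \<subseteq> carrier R"
  obtains M where "countable M" "S \<subseteq> M" "M \<subseteq> carrier R" "\<one> \<in> M"
    "\<And>u v. u \<in> M \<Longrightarrow> v \<in> M \<Longrightarrow> u \<otimes> v \<in> M"
proof
  let ?p = "\<lambda>ws. foldr (\<otimes>) ws \<one>"
  let ?M = "?p ` lists S"
  have closed: "?p ws \<in> carrier R" if "ws \<in> lists S" for ws
    using that assms(2) by (induction ws) auto
  then show "?M \<subseteq> carrier R" by blast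
  show "countable ?M" using assms(1) by simp
  show "S \<subseteq> ?M"
  proof
    fix s assume "s \<in> S"
    then show "s \<in> ?M" using assms(2) by (intro image_eqI[of _ _ "[s]"]) auto
  qed
  show "\<one> \<in> ?M" by (intro image_eqI[of _ _ "[]"]) auto
  fix u v assume "u \<in> ?M" "v \<in> ?M"
  then obtain us vs where L: "us \<in> lists S" "u = ?p us" "vs \<in> lists S" "v = ?p vs" by blast
  have "?p us \<otimes> ?p vs = ?p (us @ vs)"
    using L(1)
  proof (induction us)
    case Nil
    then show ?case using closed[OF L(3)] by simp
  next
    case (Cons w us)
    then have R: "w \<in> carrier R" "?p us \<in> carrier R" using closed[of us] assms(2) by auto
    have "?p (w # us) \<otimes> ?p vs = w \<otimes> (?p us \<otimes> ?p vs)"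
      using R closed[OF L(3)] by (simp add: m_assoc)
    then show ?case using Cons.IH by simp
  qed
  then show "u \<otimes> v \<in> ?M" using L by (intro image_eqI[of _ _ "us @ vs"]) auto
qed

theorem proposition7:
  fixes K :: "('a, 'c) ring_scheme" and m \<kk> :: "'a set"
  assumes "complete_local_noetherian_ring K m"
    and "equicharacteristic K m"
    and "0 < krull_dim K"
    and "field_of_representatives \<kk> K m"
  shows "\<not> finitely_generated_algebra (K Quot m) (residue_algebra K m \<kk>)"
proof
  interpret complete_local_noetherian_ring K m by fact
  interpret m: maximalideal m K by (rule maximal)
  assume "finitely_generated_algebra (K Quot m) (residue_algebra K m \<kk>)"
  then obtain S where S: "finite S" "S \<subseteq> carrier K"
    and gen: "generate_algebra (K Quot m) (residue_algebra K m \<kk>) S = carrier K"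
    by (auto simp: finitely_generated_algebra_def residue_algebra_def)
  obtain M where M: "countable M" "S \<subseteq> M" "M \<subseteq> carrier K" "\<one>\<^bsub>K\<^esub> \<in> M"
    "\<And>u v. u \<in> M \<Longrightarrow> v \<in> M \<Longrightarrow> u \<otimes>\<^bsub>K\<^esub> v \<in> M"
    using exists_countable_monoid[OF countable_finite[OF S(1)] S(2)] by metis
  have "carrier K \<subseteq> (\<Union>Us\<in>lists M. Span \<kk> Us)"
    using generate_algebra_subset_spans[OF assms(4) M(3-5,2)] gen by simp
  then obtain j where "ideal_power K m j \<subseteq> {\<zero>\<^bsub>K\<^esub>}"
    using ideal_power_eq_zero_if_countable_spans[OF m.is_ideal metric complete
        subfield_field_of_representatives[OF assms(4)] M(1,3)] by blast
  then have "krull_dim K = 0" using krull_dim_eq_0_if_maximal_nilpotent[OF maximal] by blast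
  then show False using assms(3) by simp
qed

end
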